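(* Every system of weakly-guarded contractions $\{X_i\succeq E_i\}_{i\in I}$ (with no restriction on the use of sums) has a unique solution for rooted bisimilarity: if $\tilde P$ and $\tilde Q$ satisfy $P_i\succeq^c_{\mathrm{bis}}E_i[\tilde P]$ and $Q_i\succeq^c_{\mathrm{bis}}E_i[\tilde Q]$ for all $i\in I$, then $P_i\approx^c Q_i$ for all $i\in I$ (and hence also $P_i\approx Q_i$).
   Context: CCS processes over names $\mathscr L$ (actions $\mu ::= \tau\mid a\mid\overline a$): $P ::= \mathbf 0 \mid \mu.P \mid P_1|P_2 \mid P_1+P_2 \mid (\nu a)P \mid A \mid \mathrm{rec}\,A.\,P \mid P[rf]$, with the standard SOS semantics. $\Rightarrow^{\epsilon}$ is the reflexive–transitive closure of $\xrightarrow{\tau}$; $P\Rightarrow^{\mu}P'$ means $P\Rightarrow^{\epsilon}\xrightarrow{\mu}\Rightarrow^{\epsilon}P'$; $P\,\widehat{\Rightarrow^{\mu}}\,P'$ means $P\Rightarrow^{\mu}P'$ or ($\mu=\tau$ and $P=P'$); $P\,\widehat{\xrightarrow{\mu}}\,P'$ means $P\xrightarrow{\mu}P'$ or ($\mu=\tau$, $P=P'$). Weak bisimilarity $\approx$: largest relation such that whenever $P\approx Q$, $P\xrightarrow{\mu}P'$ implies $Q\,\widehat{\Rightarrow^{\mu}}\,Q'$ with $P'\approx Q'$, and symmetrically. Rooted bisimilarity: $P\approx^c Q$ iff $P\xrightarrow{\mu}P'$ implies $Q\Rightarrow^{\mu}Q'$ with $P'\approx Q'$, and $Q\xrightarrow{\mu}Q'$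 implies $P\Rightarrow^{\mu}P'$ with $P'\approx Q'$. Bisimilarity contraction $\succeq_{\mathrm{bis}}$: $P\succeq_{\mathrm{bis}}Q$ iff $P\mathcal R Q$ for some relation $\mathcal R$ such that whenever $P\mathcal RQ$: $P\xrightarrow{\mu}P'$ implies $Q\,\widehat{\xrightarrow{\mu}}\,Q'$ with $P'\mathcal RQ'$, and $Q\xrightarrow{\mu}Q'$ implies $P\,\widehat{\Rightarrow^{\mu}}\,P'$ with $P'\approx Q'$. Rooted contraction: $P\succeq^c_{\mathrm{bis}}Q$ iff $P\xrightarrow{\mu}P'$ implies $Q\xrightarrow{\mu}Q'$ with $P'\succeq_{\mathrm{bis}}Q'$, and $Q\xrightarrow{\mu}Q'$ implies $P\Rightarrow^{\mu}P'$ with $P'\approx Q'$. A system of contractions $\{X_i\succeq E_i\}_{i\in I}$ ($I$ countable) consists of CCS expressions $E_i$ possibly containing variables $X_j$; $E[\tilde P]$ is syntactic replacement of each $X_j$ by $P_j$. It is weakly guarded if in each $E_i$ every occurrence of a variable lies underneath a prefix $\mu.\,$. *)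

theory Defs
  imports Main "HOL-Library.Countable_Set"
begin

section \<open>Syntax\<close>

datatype 'a label = Name 'a | Coname 'a

datatype 'a action = Tau | Vis "'a label"

primrec complement :: "'a label \<Rightarrow> 'a label" where
  "complement (Name a) = Coname a"
| "complement (Coname a) = Name a"

text \<open>
  A relabelling function acts on labels, commutes with complementation and fixes \<open>\<tau>\<close>.
  Such a function is determined by its values on names, and any choice of these values is possible;
  so it is represented by a map from names to labels, which \<open>relabel\<close> extends to actions.
\<close>

primrec relabel_label :: "('a \<Rightarrow> 'a label) \<Rightarrow> 'a label \<Rightarrow> 'a label" where
  "relabel_label rf (Name a) = rf a"
| "relabel_label rf (Coname a) = complement (rf a)"

primrec relabel :: "('a \<Rightarrow> 'a label) \<Rightarrow> 'a action \<Rightarrow> 'a action" where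
  "relabel rf Tau = Tau"
| "relabel rf (Vis l) = Vis (relabel_label rf l)"

text \<open>
  Expressions over names \<open>'a\<close> and equation variables indexed by \<open>'i\<close>. Agent variables
  \<open>A\<close>, bound by \<open>rec A. P\<close>, are de Bruijn indices: \<open>Agent n\<close> refers to the \<open>n\<close>-th
  enclosing \<open>Rec\<close>, and is a free agent variable if there are at most \<open>n\<close> of these.
  Processes are the expressions without equation variables.
\<close>

datatype (dead 'a, eqvars: 'i) ccs =
    EqVar 'i
  | Null
  | Prefix "'a action" "('a, 'i) ccs"
  | Par "('a, 'i) ccs" "('a, 'i) ccs"
  | Sum "('a, 'i) ccs" "('a, 'i) ccs"
  | Res 'a "('a, 'i) ccs"
  | Agent nat
  | Rec "('a, 'i) ccs"
  | Relab "('a, 'i) ccs" "'a \<Rightarrow> 'a label"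

definition process :: "('a, 'i) ccs \<Rightarrow> bool" where
  "process P \<longleftrightarrow> eqvars P = {}"

primrec lift :: "nat \<Rightarrow> ('a, 'i) ccs \<Rightarrow> ('a, 'i) ccs" where
  "lift k (EqVar i) = EqVar i"
| "lift k Null = Null"
| "lift k (Prefix \<mu> E) = Prefix \<mu> (lift k E)"
| "lift k (Par E F) = Par (lift k E) (lift k F)"
| "lift k (Sum E F) = Sum (lift k E) (lift k F)"
| "lift k (Res a E) = Res a (lift k E)"
| "lift k (Agent n) = (if n < k then Agent n else Agent (Suc n))"
| "lift k (Rec E) = Rec (lift (Suc k) E)"
| "lift k (Relab E rf) = Relab (lift k E) rf"

text \<open>
  \<open>agent_subst k G E\<close> is \<open>E{G/A}\<close>, with \<open>A\<close> the agent variable of index \<open>k\<close>, whose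
  binder is removed.
\<close>

primrec agent_subst :: "nat \<Rightarrow> ('a, 'i) ccs \<Rightarrow> ('a, 'i) ccs \<Rightarrow> ('a, 'i) ccs" where
  "agent_subst k G (EqVar i) = EqVar i"
| "agent_subst k G Null = Null"
| "agent_subst k G (Prefix \<mu> E) = Prefix \<mu> (agent_subst k G E)"
| "agent_subst k G (Par E F) = Par (agent_subst k G E) (agent_subst k G F)"
| "agent_subst k G (Sum E F) = Sum (agent_subst k G E) (agent_subst k G F)"
| "agent_subst k G (Res a E) = Res a (agent_subst k G E)"
| "agent_subst k G (Agent n) =
     (if n < k then Agent n else if n = k then G else Agent (n - 1))"
| "agent_subst k G (Rec E) = Rec (agent_subst (Suc k) (lift 0 G) E)"
| "agent_subst k G (Relab E rf) = Relab (agent_subst k G E) rf"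

text \<open>
  \<open>inst P E\<close> is \<open>E[P]\<close>. Under \<open>Rec\<close> the replacing processes are lifted, so that their
  free agent variables are not captured; on processes without free agent variables lifting is
  the identity.
\<close>

primrec inst :: "('i \<Rightarrow> ('a, 'i) ccs) \<Rightarrow> ('a, 'i) ccs \<Rightarrow> ('a, 'i) ccs" where
  "inst P (EqVar i) = P i"
| "inst P Null = Null"
| "inst P (Prefix \<mu> E) = Prefix \<mu> (inst P E)"
| "inst P (Par E F) = Par (inst P E) (inst P F)"
| "inst P (Sum E F) = Sum (inst P E) (inst P F)"
| "inst P (Res a E) = Res a (inst P E)"
| "inst P (Agent n) = Agent n"
| "inst P (Rec E) = Rec (inst (\<lambda>i. lift 0 (P i)) E)"
| "inst P (Relab E rf) = Relab (inst P E) rf"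

primrec weakly_guarded :: "('a, 'i) ccs \<Rightarrow> bool" where
  "weakly_guarded (EqVar i) \<longleftrightarrow> False"
| "weakly_guarded Null \<longleftrightarrow> True"
| "weakly_guarded (Prefix \<mu> E) \<longleftrightarrow> True"
| "weakly_guarded (Par E F) \<longleftrightarrow> weakly_guarded E \<and> weakly_guarded F"
| "weakly_guarded (Sum E F) \<longleftrightarrow> weakly_guarded E \<and> weakly_guarded F"
| "weakly_guarded (Res a E) \<longleftrightarrow> weakly_guarded E"
| "weakly_guarded (Agent n) \<longleftrightarrow> True"
| "weakly_guarded (Rec E) \<longleftrightarrow> weakly_guarded E"
| "weakly_guarded (Relab E rf) \<longleftrightarrow> weakly_guarded E"


section \<open>Operational semantics\<close>

inductive transition :: "('a, 'i) ccs \<Rightarrow> 'a action \<Rightarrow> ('a, 'i) ccs \<Rightarrow> bool" where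
  Prefix: "transition (Prefix \<mu> P) \<mu> P"
| SumL: "transition P \<mu> P' \<Longrightarrow> transition (Sum P Q) \<mu> P'"
| SumR: "transition Q \<mu> Q' \<Longrightarrow> transition (Sum P Q) \<mu> Q'"
| ParL: "transition P \<mu> P' \<Longrightarrow> transition (Par P Q) \<mu> (Par P' Q)"
| ParR: "transition Q \<mu> Q' \<Longrightarrow> transition (Par P Q) \<mu> (Par P Q')"
| Com: "transition P (Vis l) P' \<Longrightarrow> transition Q (Vis (complement l)) Q' \<Longrightarrow> transition (Par P Q) Tau (Par P' Q')"
| Res: "transition P \<mu> P' \<Longrightarrow> \<mu> \<noteq> Vis (Name a) \<Longrightarrow> \<mu> \<noteq> Vis (Coname a) \<Longrightarrow>
    transition (Res a P) \<mu> (Res a P')"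
| Rec: "transition (agent_subst 0 (Rec P) P) \<mu> P' \<Longrightarrow> transition (Rec P) \<mu> P'"
| Relab: "transition P \<mu> P' \<Longrightarrow> transition (Relab P rf) (relabel rf \<mu>) (Relab P' rf)"

definition eps_trans :: "('a, 'i) ccs \<Rightarrow> ('a, 'i) ccs \<Rightarrow> bool" where
  "eps_trans = (\<lambda>P Q. transition P Tau Q)\<^sup>*\<^sup>*"

definition weak_trans :: "('a, 'i) ccs \<Rightarrow> 'a action \<Rightarrow> ('a, 'i) ccs \<Rightarrow> bool" where
  "weak_trans P \<mu> P' \<longleftrightarrow> (\<exists>P1 P2. eps_trans P P1 \<and> transition P1 \<mu> P2 \<and> eps_trans P2 P')"

definition weak_trans_hat :: "('a, 'i) ccs \<Rightarrow> 'a action \<Rightarrow> ('a, 'i) ccs \<Rightarrow> bool" where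
  "weak_trans_hat P \<mu> P' \<longleftrightarrow> weak_trans P \<mu> P' \<or> (\<mu> = Tau \<and> P = P')"

definition trans_hat :: "('a, 'i) ccs \<Rightarrow> 'a action \<Rightarrow> ('a, 'i) ccs \<Rightarrow> bool" where
  "trans_hat P \<mu> P' \<longleftrightarrow> transition P \<mu> P' \<or> (\<mu> = Tau \<and> P = P')"


section \<open>Behavioural relations\<close>

definition weak_bisimulation :: "(('a, 'i) ccs \<Rightarrow> ('a, 'i) ccs \<Rightarrow> bool) \<Rightarrow> bool" where
  "weak_bisimulation R \<longleftrightarrow> (\<forall>P Q. R P Q \<longrightarrow>
     (\<forall>\<mu> P'. transition P \<mu> P' \<longrightarrow> (\<exists>Q'. weak_trans_hat Q \<mu> Q' \<and> R P' Q')) \<and>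
     (\<forall>\<mu> Q'. transition Q \<mu> Q' \<longrightarrow> (\<exists>P'. weak_trans_hat P \<mu> P' \<and> R P' Q')))"

definition weak_bisimilar :: "('a, 'i) ccs \<Rightarrow> ('a, 'i) ccs \<Rightarrow> bool"  (infix "\<approx>" 50) where
  "P \<approx> Q \<longleftrightarrow> (\<exists>R. weak_bisimulation R \<and> R P Q)"

definition rooted_bisimilar :: "('a, 'i) ccs \<Rightarrow> ('a, 'i) ccs \<Rightarrow> bool"  (infix "\<approx>\<^sup>c" 50) where
  "P \<approx>\<^sup>c Q \<longleftrightarrow>
     (\<forall>\<mu> P'. transition P \<mu> P' \<longrightarrow> (\<exists>Q'. weak_trans Q \<mu> Q' \<and> P' \<approx> Q')) \<and>
     (\<forall>\<mu> Q'. transition Q \<mu> Q' \<longrightarrow> (\<exists>P'. weak_trans P \<mu> P' \<and> P' \<approx> Q'))"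

definition bisim_contraction :: "(('a, 'i) ccs \<Rightarrow> ('a, 'i) ccs \<Rightarrow> bool) \<Rightarrow> bool" where
  "bisim_contraction R \<longleftrightarrow> (\<forall>P Q. R P Q \<longrightarrow>
     (\<forall>\<mu> P'. transition P \<mu> P' \<longrightarrow> (\<exists>Q'. trans_hat Q \<mu> Q' \<and> R P' Q')) \<and>
     (\<forall>\<mu> Q'. transition Q \<mu> Q' \<longrightarrow> (\<exists>P'. weak_trans_hat P \<mu> P' \<and> P' \<approx> Q')))"

definition contracts :: "('a, 'i) ccs \<Rightarrow> ('a, 'i) ccs \<Rightarrow> bool"
    (infix "\<succeq>\<^sub>b\<^sub>i\<^sub>s" 50) where
  "P \<succeq>\<^sub>b\<^sub>i\<^sub>s Q \<longleftrightarrow> (\<exists>R. bisim_contraction R \<and> R P Q)"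

definition rooted_contracts :: "('a, 'i) ccs \<Rightarrow> ('a, 'i) ccs \<Rightarrow> bool"
    (infix "\<succeq>\<^sup>c\<^sub>b\<^sub>i\<^sub>s" 50) where
  "P \<succeq>\<^sup>c\<^sub>b\<^sub>i\<^sub>s Q \<longleftrightarrow>
     (\<forall>\<mu> P'. transition P \<mu> P' \<longrightarrow> (\<exists>Q'. transition Q \<mu> Q' \<and> P' \<succeq>\<^sub>b\<^sub>i\<^sub>s Q')) \<and>
     (\<forall>\<mu> Q'. transition Q \<mu> Q' \<longrightarrow> (\<exists>P'. weak_trans P \<mu> P' \<and> P' \<approx> Q'))"


section \<open>Systems of contractions\<close>

definition contraction_system :: "'i set \<Rightarrow> ('i \<Rightarrow> ('a, 'i) ccs) \<Rightarrow> bool" where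
  "contraction_system I E \<longleftrightarrow> countable I \<and> (\<forall>i\<in>I. eqvars (E i) \<subseteq> I)"

definition rooted_solution ::
    "'i set \<Rightarrow> ('i \<Rightarrow> ('a, 'i) ccs) \<Rightarrow> ('i \<Rightarrow> ('a, 'i) ccs) \<Rightarrow> bool" where
  "rooted_solution I E P \<longleftrightarrow>
     (\<forall>i\<in>I. process (P i)) \<and> (\<forall>i\<in>I. P i \<succeq>\<^sup>c\<^sub>b\<^sub>i\<^sub>s inst P (E i))"

end

theory Submission imports Defs begin

text \<open>
  A step \<open>C[P] \<rightarrow> R\<close> that uses a step of some \<open>P i\<close> is matched by a strong step of \<open>E i [P]\<close>; by weak
  guardedness the latter is a step of the open expression \<open>E i\<close>, hence available to \<open>E i [Q]\<close> and so,
  weakly, to \<open>Q i\<close>. Therefore \<open>R \<succeq> C'[P]\<close> and \<open>C[Q]\<close> weakly reaches a process bisimilar to \<open>C'[Q]\<close>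
  for some \<open>C'\<close>. Only static contexts surround a derivative, so no congruence property for
  sums or recursion is required. Since the contraction on the challenger's side matches strong steps by
  at most one strong step, the argument iterates along weak transitions, and
  \<open>{(A, B). \<exists>C. A \<approx> C[P] \<and> C[Q] \<approx> B}\<close> is a weak bisimulation.
\<close>

section \<open>Weak transitions\<close>

lemma eps_trans_refl [simp]: "eps_trans P P"
  by (simp add: eps_trans_def)

lemma eps_trans_trans: "eps_trans P Q \<Longrightarrow> eps_trans Q R \<Longrightarrow> eps_trans P R"
  unfolding eps_trans_def by (rule rtranclp_trans)

lemma eps_trans_step: "eps_trans P Q \<Longrightarrow> transition Q Tau R \<Longrightarrow> eps_trans P R"
  unfolding eps_trans_def by (rule rtranclp.rtrancl_into_rtrancl)

lemma transition_eps_trans: "transition P Tau Q \<Longrightarrow> eps_trans P Q"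
  using eps_trans_step eps_trans_refl by blast

lemma eps_trans_induct [consumes 1, case_names refl step]:
  assumes "eps_trans P Q"
    and "S P"
    and "\<And>Q R. eps_trans P Q \<Longrightarrow> transition Q Tau R \<Longrightarrow> S Q \<Longrightarrow> S R"
  shows "S Q"
  using assms unfolding eps_trans_def by (induction rule: rtranclp_induct) auto

lemma transition_weak_trans: "transition P \<mu> Q \<Longrightarrow> weak_trans P \<mu> Q"
  unfolding weak_trans_def using eps_trans_refl by blast

lemma weak_trans_eps:
  "eps_trans P P1 \<Longrightarrow> weak_trans P1 \<mu> P2 \<Longrightarrow> eps_trans P2 P3 \<Longrightarrow> weak_trans P \<mu> P3"
  unfolding weak_trans_def using eps_trans_trans by metis

text \<open>A nonempty silent path ends in a silent step, which serves as the distinguished step of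
  \<open>weak_trans\<close>; the empty path is the idle alternative.\<close>

lemma weak_trans_hat_Tau: "weak_trans_hat P Tau Q \<longleftrightarrow> eps_trans P Q"
proof
  show "weak_trans_hat P Tau Q \<Longrightarrow> eps_trans P Q"
    unfolding weak_trans_hat_def weak_trans_def
    by (blast intro: eps_trans_step eps_trans_trans eps_trans_refl)
next
  assume "eps_trans P Q"
  then show "weak_trans_hat P Tau Q"
  proof (induction rule: eps_trans_induct)
    case refl
    show ?case by (simp add: weak_trans_hat_def)
  next
    case (step Q R)
    then show ?case
      unfolding weak_trans_hat_def weak_trans_def using eps_trans_refl by blast
  qed
qed

lemma weak_trans_hat_eps:
  "eps_trans P P1 \<Longrightarrow> weak_trans_hat P1 \<mu> P2 \<Longrightarrow> eps_trans P2 P3 \<Longrightarrow> weak_trans_hat P \<mu> P3"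
proof (cases "\<mu> = Tau")
  case True
  assume "eps_trans P P1" "weak_trans_hat P1 \<mu> P2" "eps_trans P2 P3"
  then show ?thesis using True eps_trans_trans by (metis weak_trans_hat_Tau)
next
  case False
  assume "eps_trans P P1" "weak_trans_hat P1 \<mu> P2" "eps_trans P2 P3"
  then show ?thesis using False weak_trans_eps by (metis weak_trans_hat_def)
qed

lemma weak_trans_hatI: "weak_trans P \<mu> Q \<Longrightarrow> weak_trans_hat P \<mu> Q"
  by (simp add: weak_trans_hat_def)

lemma weak_trans_hat_Vis [simp]: "weak_trans_hat P (Vis l) Q \<longleftrightarrow> weak_trans P (Vis l) Q"
  by (simp add: weak_trans_hat_def)

lemma trans_hat_weak: "trans_hat P \<mu> Q \<Longrightarrow> weak_trans_hat P \<mu> Q"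
  by (auto simp: trans_hat_def weak_trans_hat_def transition_weak_trans)

section \<open>Closure of weak transitions under the process operators\<close>

lemma eps_trans_map:
  assumes "\<And>P P'. transition P Tau P' \<Longrightarrow> transition (f P) Tau (f P')" and "eps_trans P P'"
  shows "eps_trans (f P) (f P')"
  using assms(2)
proof (induction rule: eps_trans_induct)
  case (step Q R)
  then show ?case using assms(1) eps_trans_step by blast
qed simp

lemma weak_trans_map:
  assumes "\<And>P P'. transition P Tau P' \<Longrightarrow> transition (f P) Tau (f P')"
    and "\<And>P P'. transition P \<mu> P' \<Longrightarrow> transition (f P) \<nu> (f P')"
    and "weak_trans P \<mu> P'"
  shows "weak_trans (f P) \<nu> (f P')"
  using assms(3) eps_trans_map[of f, OF assms(1)] assms(2) unfolding weak_trans_def by blast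

text \<open>The first step, silent or not, resolves the choice, and the rest of the path is that of
  the summand. With \<open>weak_trans_hat\<close> this fails, since idling leaves the sum in
  place.\<close>

lemma weak_trans_Sum:
  assumes "weak_trans P \<mu> P'"
  shows "weak_trans (Sum P Q) \<mu> P'" and "weak_trans (Sum Q P) \<mu> P'"
proof -
  obtain P1 P2 where P: "eps_trans P P1" "transition P1 \<mu> P2" "eps_trans P2 P'"
    using assms unfolding weak_trans_def by blast
  have *: "P1 = P \<or> (\<exists>P0. transition P Tau P0 \<and> eps_trans P0 P1)"
    using P(1) unfolding eps_trans_def by (metis converse_rtranclpE)
  show "weak_trans (Sum P Q) \<mu> P'"
    unfolding weak_trans_def
    using * P(2,3) by (meson SumL eps_trans_refl eps_trans_trans transition_eps_trans)
  show "weak_trans (Sum Q P) \<mu> P'"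
    unfolding weak_trans_def
    using * P(2,3) by (meson SumR eps_trans_refl eps_trans_trans transition_eps_trans)
qed

text \<open>As for sums: only the first step has to be lifted from the unfolding to the recursion,
  and \<open>weak_trans\<close> guarantees that there is one.\<close>

lemma weak_trans_Rec:
  assumes "weak_trans (agent_subst 0 (Rec P) P) \<mu> P'"
  shows "weak_trans (Rec P) \<mu> P'"
proof -
  let ?U = "agent_subst 0 (Rec P) P"
  obtain P1 P2 where P: "eps_trans ?U P1" "transition P1 \<mu> P2" "eps_trans P2 P'"
    using assms unfolding weak_trans_def by blast
  have "P1 = ?U \<or> (\<exists>P0. transition ?U Tau P0 \<and> eps_trans P0 P1)"
    using P(1) unfolding eps_trans_def by (metis converse_rtranclpE)
  then show ?thesis
    unfolding weak_trans_def
    using P(2,3) by (meson transition.Rec eps_trans_refl eps_trans_trans transition_eps_trans)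
qed

lemma eps_trans_Par:
  assumes "eps_trans P P'" and "eps_trans Q Q'"
  shows "eps_trans (Par P Q) (Par P' Q')"
  using eps_trans_map[of "\<lambda>X. Par X Q", OF ParL assms(1)]
    eps_trans_map[of "Par P'", OF ParR assms(2)] eps_trans_trans by blast

lemma weak_trans_ParL: "weak_trans P \<mu> P' \<Longrightarrow> weak_trans (Par P Q) \<mu> (Par P' Q)"
  by (rule weak_trans_map[of "\<lambda>X. Par X Q"]) (auto intro: ParL)

lemma weak_trans_ParR: "weak_trans Q \<mu> Q' \<Longrightarrow> weak_trans (Par P Q) \<mu> (Par P Q')"
  by (rule weak_trans_map[of "Par P"]) (auto intro: ParR)

lemma weak_trans_Com:
  assumes "weak_trans P (Vis l) P'" and "weak_trans Q (Vis (complement l)) Q'"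
  shows "weak_trans (Par P Q) Tau (Par P' Q')"
  using assms eps_trans_Par Com unfolding weak_trans_def by meson

lemma weak_trans_Res:
  "weak_trans P \<mu> P' \<Longrightarrow> \<mu> \<noteq> Vis (Name a) \<Longrightarrow> \<mu> \<noteq> Vis (Coname a) \<Longrightarrow>
    weak_trans (Res a P) \<mu> (Res a P')"
  by (rule weak_trans_map[of "Res a"]) (auto intro: transition.Res)

lemma weak_trans_Relab: "weak_trans P \<mu> P' \<Longrightarrow> weak_trans (Relab P rf) (relabel rf \<mu>) (Relab P' rf)"
  by (rule weak_trans_map[of "\<lambda>X. Relab X rf"])
    \<comment> \<open>Relabelling fixes \<open>Tau\<close>, so the silent steps before and after the
      distinguished one remain silent.\<close>
    (use transition.Relab[of _ Tau _ rf] in \<open>auto intro: transition.Relab\<close>)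

lemma weak_trans_hat_ParL: "weak_trans_hat P \<mu> P' \<Longrightarrow> weak_trans_hat (Par P Q) \<mu> (Par P' Q)"
  by (auto simp: weak_trans_hat_def weak_trans_ParL)

lemma weak_trans_hat_ParR: "weak_trans_hat Q \<mu> Q' \<Longrightarrow> weak_trans_hat (Par P Q) \<mu> (Par P Q')"
  by (auto simp: weak_trans_hat_def weak_trans_ParR)

lemma weak_trans_hat_Res:
  "weak_trans_hat P \<mu> P' \<Longrightarrow> \<mu> \<noteq> Vis (Name a) \<Longrightarrow> \<mu> \<noteq> Vis (Coname a) \<Longrightarrow>
    weak_trans_hat (Res a P) \<mu> (Res a P')"
  by (auto simp: weak_trans_hat_def weak_trans_Res)

lemma weak_trans_hat_Relab:
  "weak_trans_hat P \<mu> P' \<Longrightarrow> weak_trans_hat (Relab P rf) (relabel rf \<mu>) (Relab P' rf)"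
  by (auto simp: weak_trans_hat_def weak_trans_Relab)

lemma transition_ParE:
  assumes "transition (Par P Q) \<mu> R"
  obtains (ParL) P' where "R = Par P' Q" "transition P \<mu> P'"
  | (ParR) Q' where "R = Par P Q'" "transition Q \<mu> Q'"
  | (Com) l P' Q' where "\<mu> = Tau" "R = Par P' Q'"
      "transition P (Vis l) P'" "transition Q (Vis (complement l)) Q'"
  using assms by cases blast+

inductive_cases transition_ResE: "transition (Res a P) \<mu> R"
inductive_cases transition_RelabE: "transition (Relab P rf) \<mu> R"

section \<open>Weak bisimilarity\<close>

text \<open>The forward half of \<open>weak_bisimulation\<close>, isolated because the central
  relation between contexts in \<open>P\<close> and contexts in \<open>Q\<close> is asymmetric and
  only simulates in one direction.\<close>

definition weak_simulation :: "(('a, 'i) ccs \<Rightarrow> ('a, 'i) ccs \<Rightarrow> bool) \<Rightarrow> bool" where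
  "weak_simulation R \<longleftrightarrow> (\<forall>P Q \<mu> P'. R P Q \<longrightarrow> transition P \<mu> P' \<longrightarrow>
     (\<exists>Q'. weak_trans_hat Q \<mu> Q' \<and> R P' Q'))"

lemma weak_simulationD:
  assumes "weak_simulation R" and "R P Q" and "transition P \<mu> P'"
  obtains Q' where "weak_trans_hat Q \<mu> Q'" and "R P' Q'"
  using assms unfolding weak_simulation_def by blast

lemma weak_simulation_eps:
  assumes "weak_simulation R" and "R P Q" and "eps_trans P P'"
  shows "\<exists>Q'. eps_trans Q Q' \<and> R P' Q'"
  using assms(3)
proof (induction rule: eps_trans_induct)
  case refl
  show ?case using assms(2) eps_trans_refl by blast
next
  case (step P1 P2)
  then show ?case using assms(1)
    by (meson eps_trans_trans weak_simulationD weak_trans_hat_Tau)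
qed

text \<open>The challenger's path is followed one strong step at a time, and the weak answers are
  concatenated.\<close>

lemma weak_simulation_weak:
  assumes R: "weak_simulation R" and "R P Q" and "weak_trans_hat P \<mu> P'"
  shows "\<exists>Q'. weak_trans_hat Q \<mu> Q' \<and> R P' Q'"
proof (cases "weak_trans P \<mu> P'")
  case True
  then obtain P1 P2 where P: "eps_trans P P1" "transition P1 \<mu> P2" "eps_trans P2 P'"
    unfolding weak_trans_def by blast
  obtain Q1 where Q1: "eps_trans Q Q1" "R P1 Q1"
    using weak_simulation_eps[OF R assms(2) P(1)] by blast
  obtain Q2 where Q2: "weak_trans_hat Q1 \<mu> Q2" "R P2 Q2"
    using weak_simulationD[OF R Q1(2) P(2)] by blast
  obtain Q3 where Q3: "eps_trans Q2 Q3" "R P' Q3"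
    using weak_simulation_eps[OF R Q2(2) P(3)] by blast
  show ?thesis using weak_trans_hat_eps[OF Q1(1) Q2(1) Q3(1)] Q3(2) by blast
next
  case False
  then show ?thesis using assms(2,3) unfolding weak_trans_hat_def by blast
qed

lemma weak_bisimulation_symI:
  assumes "weak_simulation R" and "\<And>P Q. R P Q \<Longrightarrow> R Q P"
  shows "weak_bisimulation R"
  unfolding weak_bisimulation_def
  using assms(2) weak_simulationD[OF assms(1)] by metis

lemma weak_bisimilar_coinduct:
  assumes "R P Q" and "weak_simulation R" and "\<And>P Q. R P Q \<Longrightarrow> R Q P"
  shows "P \<approx> Q"
  using assms weak_bisimulation_symI unfolding weak_bisimilar_def by blast

lemma weak_simulation_bisimilar: "weak_simulation (\<approx>)"
  unfolding weak_simulation_def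
proof (intro allI impI)
  fix P Q :: "('a, 'b) ccs" and \<mu> P'
  assume "P \<approx> Q" and "transition P \<mu> P'"
  moreover from this obtain R where R: "weak_bisimulation R" "R P Q"
    unfolding weak_bisimilar_def by blast
  ultimately obtain Q' where "weak_trans_hat Q \<mu> Q'" "R P' Q'"
    unfolding weak_bisimulation_def by blast
  then show "\<exists>Q'. weak_trans_hat Q \<mu> Q' \<and> P' \<approx> Q'"
    unfolding weak_bisimilar_def using R(1) by blast
qed

lemma weak_bisimilar_weak:
  "P \<approx> Q \<Longrightarrow> weak_trans_hat P \<mu> P' \<Longrightarrow> \<exists>Q'. weak_trans_hat Q \<mu> Q' \<and> P' \<approx> Q'"
  by (rule weak_simulation_weak[OF weak_simulation_bisimilar])

lemma weak_bisimilar_step: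
  "P \<approx> Q \<Longrightarrow> transition P \<mu> P' \<Longrightarrow> \<exists>Q'. weak_trans_hat Q \<mu> Q' \<and> P' \<approx> Q'"
  using weak_simulation_bisimilar unfolding weak_simulation_def by blast

lemma weak_bisimilar_refl: "P \<approx> P"
  by (rule weak_bisimilar_coinduct[of "(=)"])
    (auto simp: weak_simulation_def weak_trans_hat_def intro: transition_weak_trans)

lemma weak_bisimilar_sym: "P \<approx> Q \<Longrightarrow> Q \<approx> P"
proof -
  assume "P \<approx> Q"
  then obtain R where "weak_bisimulation R" "R P Q" unfolding weak_bisimilar_def by blast
  then have "weak_bisimulation (\<lambda>P Q. R Q P)" unfolding weak_bisimulation_def by blast
  then show "Q \<approx> P" unfolding weak_bisimilar_def using \<open>R P Q\<close> by blast
qed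

lemma weak_bisimilar_step_back:
  "P \<approx> Q \<Longrightarrow> transition Q \<mu> Q' \<Longrightarrow> \<exists>P'. weak_trans_hat P \<mu> P' \<and> P' \<approx> Q'"
  using weak_bisimilar_step weak_bisimilar_sym by blast

lemma weak_bisimilar_trans:
  assumes "P \<approx> Q" and "Q \<approx> S"
  shows "P \<approx> S"
proof (rule weak_bisimilar_coinduct[of "\<lambda>P S. \<exists>Q. P \<approx> Q \<and> Q \<approx> S"])
  show "\<exists>Q. P \<approx> Q \<and> Q \<approx> S" using assms by blast
  show "weak_simulation (\<lambda>P S. \<exists>Q. P \<approx> Q \<and> Q \<approx> S)"
    unfolding weak_simulation_def using weak_bisimilar_step weak_bisimilar_weak by meson
qed (blast intro: weak_bisimilar_sym)

section \<open>Weak bisimilarity is preserved by the static operators\<close>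

lemma weak_bisimilar_Par:
  assumes "P1 \<approx> Q1" and "P2 \<approx> Q2"
  shows "Par P1 P2 \<approx> Par Q1 Q2"
proof -
  let ?R = "\<lambda>(P :: ('a, 'b) ccs) Q.
    \<exists>P1 P2 Q1 Q2. P = Par P1 P2 \<and> Q = Par Q1 Q2 \<and> P1 \<approx> Q1 \<and> P2 \<approx> Q2"
  show ?thesis
  proof (rule weak_bisimilar_coinduct[of ?R])
    show "?R (Par P1 P2) (Par Q1 Q2)" using assms by blast
    show "weak_simulation ?R"
      unfolding weak_simulation_def
    proof (intro allI impI)
      fix P Q :: "('a, 'b) ccs" and \<mu> P'
      assume "?R P Q" "transition P \<mu> P'"
      then obtain P1 P2 Q1 Q2 where P: "P = Par P1 P2" "Q = Par Q1 Q2" "P1 \<approx> Q1" "P2 \<approx> Q2"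
        by blast
      have "transition (Par P1 P2) \<mu> P'" using \<open>transition P \<mu> P'\<close> P(1) by simp
      then show "\<exists>Q'. weak_trans_hat Q \<mu> Q' \<and> ?R P' Q'"
      proof (cases rule: transition_ParE)
        case (ParL P1')
        then obtain Q1' where "weak_trans_hat Q1 \<mu> Q1'" "P1' \<approx> Q1'"
          using weak_bisimilar_step[OF P(3)] by blast
        then have "weak_trans_hat Q \<mu> (Par Q1' Q2)" "?R P' (Par Q1' Q2)"
          using ParL P by (auto intro: weak_trans_hat_ParL)
        then show ?thesis by blast
      next
        case (ParR P2')
        then obtain Q2' where "weak_trans_hat Q2 \<mu> Q2'" "P2' \<approx> Q2'"
          using weak_bisimilar_step[OF P(4)] by blast
        then have "weak_trans_hat Q \<mu> (Par Q1 Q2')" "?R P' (Par Q1 Q2')"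
          using ParR P by (auto intro: weak_trans_hat_ParR)
        then show ?thesis by blast
      next
        case (Com l P1' P2')
        \<comment> \<open>A visible action cannot be answered by idling, so both components really
          move and can synchronise.\<close>
        then obtain Q1' Q2' where "weak_trans Q1 (Vis l) Q1'" "P1' \<approx> Q1'"
          "weak_trans Q2 (Vis (complement l)) Q2'" "P2' \<approx> Q2'"
          using weak_bisimilar_step[OF P(3)] weak_bisimilar_step[OF P(4)]
          by (metis weak_trans_hat_Vis)
        then have "weak_trans_hat Q \<mu> (Par Q1' Q2')" "?R P' (Par Q1' Q2')"
          using Com P by (auto intro: weak_trans_hatI weak_trans_Com)
        then show ?thesis by blast
      qed
    qed
  qed (blast intro: weak_bisimilar_sym)
qed

lemma weak_bisimilar_Res:
  assumes "P \<approx> Q"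
  shows "Res a P \<approx> Res a Q"
proof -
  let ?R = "\<lambda>(P :: ('a, 'b) ccs) Q.
    \<exists>P1 Q1. P = Res a P1 \<and> Q = Res a Q1 \<and> P1 \<approx> Q1"
  show ?thesis
  proof (rule weak_bisimilar_coinduct[of ?R])
    show "weak_simulation ?R"
      unfolding weak_simulation_def
    proof (intro allI impI)
      fix P Q :: "('a, 'b) ccs" and \<mu> P'
      assume "?R P Q" and tr: "transition P \<mu> P'"
      then obtain P1 Q1 where P: "P = Res a P1" "Q = Res a Q1" "P1 \<approx> Q1" by blast
      obtain P1' where P': "P' = Res a P1'" "transition P1 \<mu> P1'"
        and \<mu>: "\<mu> \<noteq> Vis (Name a)" "\<mu> \<noteq> Vis (Coname a)"
        using tr unfolding P(1) by (auto elim: transition_ResE)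
      obtain Q1' where "weak_trans_hat Q1 \<mu> Q1'" "P1' \<approx> Q1'"
        using weak_bisimilar_step[OF P(3) P'(2)] by blast
      then have "weak_trans_hat Q \<mu> (Res a Q1')" "?R P' (Res a Q1')"
        using P P' \<mu> by (auto intro: weak_trans_hat_Res)
      then show "\<exists>Q'. weak_trans_hat Q \<mu> Q' \<and> ?R P' Q'" by blast
    qed
  qed (use assms weak_bisimilar_sym in blast)+
qed

lemma weak_bisimilar_Relab:
  assumes "P \<approx> Q"
  shows "Relab P rf \<approx> Relab Q rf"
proof -
  let ?R = "\<lambda>(P :: ('a, 'b) ccs) Q.
    \<exists>P1 Q1. P = Relab P1 rf \<and> Q = Relab Q1 rf \<and> P1 \<approx> Q1"
  show ?thesis
  proof (rule weak_bisimilar_coinduct[of ?R])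
    show "weak_simulation ?R"
      unfolding weak_simulation_def
    proof (intro allI impI)
      fix P Q :: "('a, 'b) ccs" and \<mu> P'
      assume "?R P Q" and tr: "transition P \<mu> P'"
      then obtain P1 Q1 where P: "P = Relab P1 rf" "Q = Relab Q1 rf" "P1 \<approx> Q1" by blast
      obtain \<nu> P1' where P': "P' = Relab P1' rf" "transition P1 \<nu> P1'" and \<mu>: "\<mu> = relabel rf \<nu>"
        using tr unfolding P(1) by (auto elim: transition_RelabE)
      obtain Q1' where "weak_trans_hat Q1 \<nu> Q1'" "P1' \<approx> Q1'"
        using weak_bisimilar_step[OF P(3) P'(2)] by blast
      then have "weak_trans_hat Q \<mu> (Relab Q1' rf)" "?R P' (Relab Q1' rf)"
        using P P' \<mu> by (auto intro: weak_trans_hat_Relab)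
      then show "\<exists>Q'. weak_trans_hat Q \<mu> Q' \<and> ?R P' Q'" by blast
    qed
  qed (use assms weak_bisimilar_sym in blast)+
qed

text \<open>After the first step the derivatives are weakly bisimilar, so the union of both
  relations is a weak bisimulation.\<close>

lemma rooted_bisimilar_imp_weak:
  assumes "P \<approx>\<^sup>c Q"
  shows "P \<approx> Q"
proof -
  have "weak_bisimulation (\<lambda>(P :: ('a, 'b) ccs) Q. P \<approx>\<^sup>c Q \<or> P \<approx> Q)"
    unfolding weak_bisimulation_def
  proof (intro allI impI conjI; elim disjE)
    fix P Q :: "('a, 'b) ccs" and \<mu> P'
    assume "P \<approx>\<^sup>c Q" "transition P \<mu> P'"
    then show "\<exists>Q'. weak_trans_hat Q \<mu> Q' \<and> (P' \<approx>\<^sup>c Q' \<or> P' \<approx> Q')"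
      unfolding rooted_bisimilar_def using weak_trans_hatI by blast
  next
    fix P Q :: "('a, 'b) ccs" and \<mu> Q'
    assume "P \<approx>\<^sup>c Q" "transition Q \<mu> Q'"
    then show "\<exists>P'. weak_trans_hat P \<mu> P' \<and> (P' \<approx>\<^sup>c Q' \<or> P' \<approx> Q')"
      unfolding rooted_bisimilar_def using weak_trans_hatI by blast
  qed (use weak_bisimilar_step weak_bisimilar_step_back in blast)+
  then show ?thesis unfolding weak_bisimilar_def using assms by blast
qed

section \<open>Bisimilarity contraction\<close>

text \<open>The backward clause of \<open>bisim_contraction\<close> ends in weak bisimilarity rather
  than in \<open>R\<close>. It therefore follows once \<open>R\<close> lies within weak
  bisimilarity, and only the forward clause has to be checked step by step.\<close>

lemma contracts_coinduct:
  assumes "R P Q"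
    and "\<And>P Q \<mu> P'. R P Q \<Longrightarrow> transition P \<mu> P' \<Longrightarrow> \<exists>Q'. trans_hat Q \<mu> Q' \<and> R P' Q'"
    and "\<And>P Q. R P Q \<Longrightarrow> P \<approx> Q"
  shows "P \<succeq>\<^sub>b\<^sub>i\<^sub>s Q"
proof -
  have "bisim_contraction R"
    unfolding bisim_contraction_def
    using assms(2) weak_bisimilar_step_back[OF assms(3)] by blast
  then show ?thesis unfolding contracts_def using assms(1) by blast
qed

lemma contracts_step: "P \<succeq>\<^sub>b\<^sub>i\<^sub>s Q \<Longrightarrow> transition P \<mu> P' \<Longrightarrow> \<exists>Q'. trans_hat Q \<mu> Q' \<and> P' \<succeq>\<^sub>b\<^sub>i\<^sub>s Q'"
proof -
  assume "P \<succeq>\<^sub>b\<^sub>i\<^sub>s Q" and "transition P \<mu> P'"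
  moreover from this obtain R where R: "bisim_contraction R" "R P Q"
    unfolding contracts_def by blast
  ultimately obtain Q' where "trans_hat Q \<mu> Q'" "R P' Q'"
    unfolding bisim_contraction_def by blast
  then show "\<exists>Q'. trans_hat Q \<mu> Q' \<and> P' \<succeq>\<^sub>b\<^sub>i\<^sub>s Q'"
    unfolding contracts_def using R(1) by blast
qed

text \<open>Backward answers leave \<open>R\<close> for weak bisimilarity, so the bisimulation is
  the union of \<open>R\<close> with weak bisimilarity.\<close>

lemma contracts_imp_weak_bisimilar:
  assumes "P \<succeq>\<^sub>b\<^sub>i\<^sub>s Q"
  shows "P \<approx> Q"
proof -
  obtain R where R: "bisim_contraction R" "R P Q"
    using assms unfolding contracts_def by blast
  have "weak_bisimulation (\<lambda>P Q. R P Q \<or> P \<approx> Q)"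
    unfolding weak_bisimulation_def
  proof (intro allI impI conjI; elim disjE)
    fix P Q \<mu> P'
    assume "R P Q" "transition P \<mu> P'"
    then show "\<exists>Q'. weak_trans_hat Q \<mu> Q' \<and> (R P' Q' \<or> P' \<approx> Q')"
      using R(1) trans_hat_weak unfolding bisim_contraction_def by blast
  next
    fix P Q \<mu> Q'
    assume "R P Q" "transition Q \<mu> Q'"
    then show "\<exists>P'. weak_trans_hat P \<mu> P' \<and> (R P' Q' \<or> P' \<approx> Q')"
      using R(1) unfolding bisim_contraction_def by blast
  qed (use weak_bisimilar_step weak_bisimilar_step_back in blast)+
  then show ?thesis unfolding weak_bisimilar_def using R(2) by blast
qed

lemma contracts_refl: "P \<succeq>\<^sub>b\<^sub>i\<^sub>s P"
  by (rule contracts_coinduct[of "(=)"]) (auto simp: trans_hat_def weak_bisimilar_refl)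

text \<open>An answer of at most one step, itself answered by at most one step, is again at most one
  step; the backward clause comes from transitivity of weak bisimilarity.\<close>

lemma contracts_trans:
  assumes "P \<succeq>\<^sub>b\<^sub>i\<^sub>s Q" and "Q \<succeq>\<^sub>b\<^sub>i\<^sub>s S"
  shows "P \<succeq>\<^sub>b\<^sub>i\<^sub>s S"
proof (rule contracts_coinduct[of "\<lambda>(P :: ('a, 'b) ccs) S. \<exists>Q. P \<succeq>\<^sub>b\<^sub>i\<^sub>s Q \<and> Q \<succeq>\<^sub>b\<^sub>i\<^sub>s S"])
  show "\<exists>S'. trans_hat S \<mu> S' \<and> (\<exists>Q'. P' \<succeq>\<^sub>b\<^sub>i\<^sub>s Q' \<and> Q' \<succeq>\<^sub>b\<^sub>i\<^sub>s S')"
    if "\<exists>Q. P \<succeq>\<^sub>b\<^sub>i\<^sub>s Q \<and> Q \<succeq>\<^sub>b\<^sub>i\<^sub>s S" and "transition P \<mu> P'" for P S :: "('a, 'b) ccs" and \<mu> P'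
    using that contracts_step unfolding trans_hat_def by metis
qed (use assms contracts_imp_weak_bisimilar weak_bisimilar_trans in blast)+

section \<open>Contraction is preserved by the static operators\<close>

lemma contracts_Par:
  assumes "P1 \<succeq>\<^sub>b\<^sub>i\<^sub>s Q1" and "P2 \<succeq>\<^sub>b\<^sub>i\<^sub>s Q2"
  shows "Par P1 P2 \<succeq>\<^sub>b\<^sub>i\<^sub>s Par Q1 Q2"
proof -
  let ?R = "\<lambda>(P :: ('a, 'b) ccs) Q.
    \<exists>P1 P2 Q1 Q2. P = Par P1 P2 \<and> Q = Par Q1 Q2 \<and> P1 \<succeq>\<^sub>b\<^sub>i\<^sub>s Q1 \<and> P2 \<succeq>\<^sub>b\<^sub>i\<^sub>s Q2"
  show ?thesis
  proof (rule contracts_coinduct[of ?R])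
    show "?R (Par P1 P2) (Par Q1 Q2)" using assms by blast
    fix P Q :: "('a, 'b) ccs" and \<mu> P'
    assume "?R P Q"
    then obtain P1 P2 Q1 Q2
      where P: "P = Par P1 P2" "Q = Par Q1 Q2" "P1 \<succeq>\<^sub>b\<^sub>i\<^sub>s Q1" "P2 \<succeq>\<^sub>b\<^sub>i\<^sub>s Q2"
      by blast
    show "P \<approx> Q"
      unfolding P by (intro weak_bisimilar_Par contracts_imp_weak_bisimilar P)
    assume "transition P \<mu> P'"
    then have "transition (Par P1 P2) \<mu> P'" using P(1) by simp
    then show "\<exists>Q'. trans_hat Q \<mu> Q' \<and> ?R P' Q'"
    proof (cases rule: transition_ParE)
      case (ParL P1')
      then obtain Q1' where "trans_hat Q1 \<mu> Q1'" "P1' \<succeq>\<^sub>b\<^sub>i\<^sub>s Q1'"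
        using contracts_step[OF P(3)] by blast
      then have "trans_hat Q \<mu> (Par Q1' Q2)" "?R P' (Par Q1' Q2)"
        using ParL P by (auto simp: trans_hat_def intro: transition.ParL)
      then show ?thesis by blast
    next
      case (ParR P2')
      then obtain Q2' where "trans_hat Q2 \<mu> Q2'" "P2' \<succeq>\<^sub>b\<^sub>i\<^sub>s Q2'"
        using contracts_step[OF P(4)] by blast
      then have "trans_hat Q \<mu> (Par Q1 Q2')" "?R P' (Par Q1 Q2')"
        using ParR P by (auto simp: trans_hat_def intro: transition.ParR)
      then show ?thesis by blast
    next
      case (Com l P1' P2')
      \<comment> \<open>Visible actions exclude the idle answer, so both components answer by one
        strong step and these combine into a single communication.\<close>
      then obtain Q1' Q2' where "transition Q1 (Vis l) Q1'" "P1' \<succeq>\<^sub>b\<^sub>i\<^sub>s Q1'"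
        "transition Q2 (Vis (complement l)) Q2'" "P2' \<succeq>\<^sub>b\<^sub>i\<^sub>s Q2'"
        using contracts_step[OF P(3)] contracts_step[OF P(4)]
        by (metis trans_hat_def action.distinct(1))
      then have "trans_hat Q \<mu> (Par Q1' Q2')" "?R P' (Par Q1' Q2')"
        using Com P by (auto simp: trans_hat_def intro: transition.Com)
      then show ?thesis by blast
    qed
  qed
qed

lemma contracts_Res:
  assumes "P \<succeq>\<^sub>b\<^sub>i\<^sub>s Q"
  shows "Res a P \<succeq>\<^sub>b\<^sub>i\<^sub>s Res a Q"
proof -
  let ?R = "\<lambda>(P :: ('a, 'b) ccs) Q.
    \<exists>P1 Q1. P = Res a P1 \<and> Q = Res a Q1 \<and> P1 \<succeq>\<^sub>b\<^sub>i\<^sub>s Q1"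
  show ?thesis
  proof (rule contracts_coinduct[of ?R])
    show "\<exists>Q'. trans_hat Q \<mu> Q' \<and> ?R P' Q'"
      if R: "?R P Q" and tr: "transition P \<mu> P'" for P Q :: "('a, 'b) ccs" and \<mu> P'
    proof -
      obtain P1 Q1 where P: "P = Res a P1" "Q = Res a Q1" "P1 \<succeq>\<^sub>b\<^sub>i\<^sub>s Q1" using R by blast
      obtain P1' where P': "P' = Res a P1'" "transition P1 \<mu> P1'"
        and \<mu>: "\<mu> \<noteq> Vis (Name a)" "\<mu> \<noteq> Vis (Coname a)"
        using tr unfolding P(1) by (auto elim: transition_ResE)
      obtain Q1' where "trans_hat Q1 \<mu> Q1'" "P1' \<succeq>\<^sub>b\<^sub>i\<^sub>s Q1'"
        using contracts_step[OF P(3) P'(2)] by blast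
      then have "trans_hat Q \<mu> (Res a Q1')" "?R P' (Res a Q1')"
        using P P' \<mu> by (auto simp: trans_hat_def intro: transition.Res)
      then show ?thesis by blast
    qed
  qed (use assms in \<open>auto intro: weak_bisimilar_Res contracts_imp_weak_bisimilar\<close>)
qed

lemma contracts_Relab:
  assumes "P \<succeq>\<^sub>b\<^sub>i\<^sub>s Q"
  shows "Relab P rf \<succeq>\<^sub>b\<^sub>i\<^sub>s Relab Q rf"
proof -
  let ?R = "\<lambda>(P :: ('a, 'b) ccs) Q.
    \<exists>P1 Q1. P = Relab P1 rf \<and> Q = Relab Q1 rf \<and> P1 \<succeq>\<^sub>b\<^sub>i\<^sub>s Q1"
  show ?thesis
  proof (rule contracts_coinduct[of ?R])
    show "\<exists>Q'. trans_hat Q \<mu> Q' \<and> ?R P' Q'"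
      if R: "?R P Q" and tr: "transition P \<mu> P'" for P Q :: "('a, 'b) ccs" and \<mu> P'
    proof -
      obtain P1 Q1 where P: "P = Relab P1 rf" "Q = Relab Q1 rf" "P1 \<succeq>\<^sub>b\<^sub>i\<^sub>s Q1" using R by blast
      obtain \<nu> P1' where P': "P' = Relab P1' rf" "transition P1 \<nu> P1'" and \<mu>: "\<mu> = relabel rf \<nu>"
        using tr unfolding P(1) by (auto elim: transition_RelabE)
      obtain Q1' where "trans_hat Q1 \<nu> Q1'" "P1' \<succeq>\<^sub>b\<^sub>i\<^sub>s Q1'"
        using contracts_step[OF P(3) P'(2)] by blast
      then have "trans_hat Q \<mu> (Relab Q1' rf)" "?R P' (Relab Q1' rf)"
        using P P' \<mu> by (auto simp: trans_hat_def intro: transition.Relab)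
      then show ?thesis by blast
    qed
  qed (use assms in \<open>auto intro: weak_bisimilar_Relab contracts_imp_weak_bisimilar\<close>)
qed

section \<open>Instantiation of equation variables\<close>

lemma lift_lift: "j \<le> k \<Longrightarrow> lift j (lift k E) = lift (Suc k) (lift j E)"
  by (induction E arbitrary: j k) auto

lemma agent_subst_lift [simp]: "agent_subst k G (lift k E) = E"
  by (induction E arbitrary: k G) auto

lemma inst_lift: "inst (\<lambda>i. lift k (P i)) (lift k E) = lift k (inst P E)"
proof (induction E arbitrary: k P)
  case (Rec E)
  show ?case using Rec[of "Suc k" "\<lambda>i. lift 0 (P i)"] by (simp add: lift_lift)
qed auto

text \<open>On the right the binder of index \<open>k\<close> is still present when \<open>P\<close>
  is inserted, hence the lifting; removing the binder cancels it by
  \<open>agent_subst_lift\<close>.\<close>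

lemma inst_agent_subst:
  "inst P (agent_subst k G E) = agent_subst k (inst P G) (inst (\<lambda>i. lift k (P i)) E)"
proof (induction E arbitrary: k G P)
  case (Rec E)
  show ?case
    using Rec[of "\<lambda>i. lift 0 (P i)" "Suc k" "lift 0 G"] by (simp add: lift_lift inst_lift)
qed auto

text \<open>The unfolding of an instance is an instance of the unfolding. This lets inductions over
  derivations pass the rule for recursion without leaving the instances of \<open>P\<close>.\<close>

lemma inst_unfold_Rec:
  "agent_subst 0 (inst P (Rec E)) (inst (\<lambda>i. lift 0 (P i)) E) = inst P (agent_subst 0 (Rec E) E)"
  by (simp add: inst_agent_subst)

lemma weakly_guarded_lift [simp]: "weakly_guarded (lift k E) \<longleftrightarrow> weakly_guarded E"
  by (induction E arbitrary: k) auto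

lemma weakly_guarded_agent_subst:
  "weakly_guarded G \<Longrightarrow> weakly_guarded E \<Longrightarrow> weakly_guarded (agent_subst k G E)"
  by (induction E arbitrary: k G) auto

lemma eqvars_lift [simp]: "eqvars (lift k E) = eqvars E"
  by (induction E arbitrary: k) auto

lemma eqvars_agent_subst: "eqvars (agent_subst k G E) \<subseteq> eqvars G \<union> eqvars E"
proof (induction E arbitrary: k G)
  case (Rec E)
  show ?case using Rec[of "Suc k" "lift 0 G"] by simp
qed (simp, blast?)+

lemma eqvars_unfold_Rec: "eqvars (agent_subst 0 (Rec E) E) \<subseteq> eqvars E"
  using eqvars_agent_subst[of 0 "Rec E" E] by simp

text \<open>Keeps the contexts reached over variables in the index set, where solutions are
  constrained.\<close>

lemma eqvars_transition: "transition E \<mu> E' \<Longrightarrow> eqvars E' \<subseteq> eqvars E"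
  by (induction rule: transition.induct) (auto dest: subsetD[OF eqvars_unfold_Rec])

section \<open>Transitions of open expressions and of their instances\<close>

lemma transition_inst: "transition E \<mu> E' \<Longrightarrow> transition (inst P E) \<mu> (inst P E')"
proof (induction rule: transition.induct)
  case (Rec E \<mu> E')
  then show ?case using transition.Rec by (simp flip: inst_unfold_Rec)
qed (auto intro: transition.intros)

text \<open>A variable below a prefix cannot take part in the first step, so the derivation already
  exists for the open expression. Guardedness excludes \<open>EqVar\<close>, hence \<open>E\<close>
  has the same top constructor as its instance. The derivative \<open>E'\<close> may be
  unguarded.\<close>

lemma weakly_guarded_transition:
  assumes "transition (inst P E) \<mu> R" and "weakly_guarded E"
  shows "\<exists>E'. transition E \<mu> E' \<and> R = inst P E'"
  using assms
proof (induction "inst P E" \<mu> R arbitrary: E rule: transition.induct)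
  case (Prefix \<mu> X)
  then show ?case by (cases E) (auto intro: transition.intros)
next
  case (SumL X \<mu> X' Y)
  then show ?case by (cases E) (auto intro: transition.intros)
next
  case (SumR Y \<mu> Y' X)
  then show ?case by (cases E) (auto intro: transition.intros)
next
  case (ParL X \<mu> X' Y)
  then obtain E1 E2 where E: "E = Par E1 E2" "X = inst P E1" "Y = inst P E2"
    by (cases E) auto
  then obtain E1' where "transition E1 \<mu> E1'" "X' = inst P E1'" using ParL by auto
  then have "transition E \<mu> (Par E1' E2) \<and> Par X' Y = inst P (Par E1' E2)"
    using E by (auto intro: transition.intros)
  then show ?case by blast
next
  case (ParR Y \<mu> Y' X)
  then obtain E1 E2 where E: "E = Par E1 E2" "X = inst P E1" "Y = inst P E2"
    by (cases E) auto
  then obtain E2' where "transition E2 \<mu> E2'" "Y' = inst P E2'" using ParR by auto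
  then have "transition E \<mu> (Par E1 E2') \<and> Par X Y' = inst P (Par E1 E2')"
    using E by (auto intro: transition.intros)
  then show ?case by blast
next
  case (Com X l X' Y Y')
  then obtain E1 E2 where E: "E = Par E1 E2" "X = inst P E1" "Y = inst P E2"
    by (cases E) auto
  then obtain E1' E2' where "transition E1 (Vis l) E1'" "X' = inst P E1'"
    "transition E2 (Vis (complement l)) E2'" "Y' = inst P E2'"
    using Com by (metis weakly_guarded.simps(4))
  then have "transition E Tau (Par E1' E2') \<and> Par X' Y' = inst P (Par E1' E2')"
    using E by (auto intro: transition.intros)
  then show ?case by blast
next
  case (Res X \<mu> X' a)
  then obtain E1 where E: "E = Res a E1" "X = inst P E1"
    by (cases E) auto
  then obtain E1' where "transition E1 \<mu> E1'" "X' = inst P E1'" using Res by auto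
  then have "transition E \<mu> (Res a E1') \<and> Res a X' = inst P (Res a E1')"
    using E Res by (auto intro: transition.intros)
  then show ?case by blast
next
  case (Rec X \<mu> X')
  then obtain E1 where E: "E = Rec E1" "X = inst (\<lambda>i. lift 0 (P i)) E1"
    by (cases E) auto
  \<comment> \<open>The unfolding may be larger than \<open>E\<close>, which is why the induction is
    over the derivation. It remains weakly guarded because the expression put in for the agent
    variable is itself weakly guarded.\<close>
  have "agent_subst 0 (Rec X) X = inst P (agent_subst 0 (Rec E1) E1)"
    using inst_unfold_Rec[of P E1] E by simp
  moreover have "weakly_guarded (agent_subst 0 (Rec E1) E1)"
    using Rec.prems E by (simp add: weakly_guarded_agent_subst)
  ultimately obtain E' where "transition (agent_subst 0 (Rec E1) E1) \<mu> E'" "X' = inst P E'"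
    using Rec.hyps(2) by blast
  then show ?case using E transition.Rec by blast
next
  case (Relab X \<mu> X' rf)
  then obtain E1 where E: "E = Relab E1 rf" "X = inst P E1"
    by (cases E) auto
  then obtain E1' where "transition E1 \<mu> E1'" "X' = inst P E1'" using Relab by auto
  then have "transition E (relabel rf \<mu>) (Relab E1' rf) \<and> Relab X' rf = inst P (Relab E1' rf)"
    using E by (auto intro: transition.intros)
  then show ?case by blast
qed

section \<open>Unique solution\<close>

locale weakly_guarded_system =
  fixes I :: "'i set" and E :: "'i \<Rightarrow> ('a, 'i) ccs"
  assumes eqvars_E: "i \<in> I \<Longrightarrow> eqvars (E i) \<subseteq> I"
    and guarded_E: "i \<in> I \<Longrightarrow> weakly_guarded (E i)"
begin

lemma solution_step:
  assumes "rooted_solution I E P" and "rooted_solution I E Q"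
    and "i \<in> I" and "transition (P i) \<mu> R"
  shows "\<exists>C' T. eqvars C' \<subseteq> I \<and> R \<succeq>\<^sub>b\<^sub>i\<^sub>s inst P C' \<and> weak_trans (Q i) \<mu> T \<and> T \<approx> inst Q C'"
proof -
  obtain R0 where R0: "transition (inst P (E i)) \<mu> R0" "R \<succeq>\<^sub>b\<^sub>i\<^sub>s R0"
    using assms unfolding rooted_solution_def rooted_contracts_def by blast
  \<comment> \<open>\<open>C'\<close> is a derivative of \<open>E i\<close> alone, so the same step
    is available after inserting \<open>Q\<close>.\<close>
  obtain C' where C': "transition (E i) \<mu> C'" "R0 = inst P C'"
    using weakly_guarded_transition[OF R0(1) guarded_E] assms(3) by blast
  \<comment> \<open>The backward clause of the rooted contraction for \<open>Q\<close> gives a weak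
    transition with at least one step, never an idle answer.\<close>
  obtain T where "weak_trans (Q i) \<mu> T" "T \<approx> inst Q C'"
    using assms(2,3) transition_inst[OF C'(1)]
    unfolding rooted_solution_def rooted_contracts_def by meson
  moreover have "eqvars C' \<subseteq> I"
    using eqvars_transition[OF C'(1)] eqvars_E assms(3) by blast
  ultimately show ?thesis using R0(2) C'(2) by blast
qed

text \<open>Contexts need not be guarded: an exposed variable is handled by
  \<open>solution_step\<close>, and every other case follows the derivation. Obtaining
  \<open>weak_trans\<close> rather than \<open>weak_trans_hat\<close> is what carries the induction
  through sums and recursion.\<close>

lemma context_step:
  assumes "rooted_solution I E P" and "rooted_solution I E Q"
    and "transition (inst P C) \<mu> R" and "eqvars C \<subseteq> I"
  shows "\<exists>C' T. eqvars C' \<subseteq> I \<and> R \<succeq>\<^sub>b\<^sub>i\<^sub>s inst P C' \<and> weak_trans (inst Q C) \<mu> T \<and> T \<approx> inst Q C'"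
  using assms(3,4)
proof (induction "inst P C" \<mu> R arbitrary: C rule: transition.induct)
  case (Prefix \<mu> X)
  show ?case
  \<comment> \<open>The prefix may belong to the context or to an inserted solution. The same split
    opens every case below; in the second situation the rule rebuilds the step of
    \<open>P i\<close>.\<close>
  proof (cases "\<exists>i. C = EqVar i")
    case True
    then show ?thesis
      using Prefix transition.Prefix[of \<mu> X] solution_step[OF assms(1,2)] by force
  next
    case False
    then obtain D where D: "C = Prefix \<mu> D" "X = inst P D"
      using Prefix by (cases C) auto
    then show ?thesis
      using Prefix.prems contracts_refl weak_bisimilar_refl
        transition_weak_trans[OF transition.Prefix, of \<mu> "inst Q D"] by fastforce
  qed
next
  case (SumL X \<mu> X' Y)
  show ?case
  proof (cases "\<exists>i. C = EqVar i")
    case True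
    then show ?thesis
      using SumL transition.SumL[OF SumL.hyps(1), of Y] solution_step[OF assms(1,2)] by force
  next
    case False
    then obtain C1 C2 where "C = Sum C1 C2" "X = inst P C1"
      using SumL by (cases C) auto
    \<comment> \<open>The sum vanishes with its first step, so the context and target found for the
      summand serve unchanged.\<close>
    then show ?thesis
      using SumL.hyps(2)[of C1] SumL.prems weak_trans_Sum(1) by fastforce
  qed
next
  case (SumR Y \<mu> Y' X)
  show ?case
  proof (cases "\<exists>i. C = EqVar i")
    case True
    then show ?thesis
      using SumR transition.SumR[OF SumR.hyps(1), of X] solution_step[OF assms(1,2)] by force
  next
    case False
    then obtain C1 C2 where "C = Sum C1 C2" "Y = inst P C2"
      using SumR by (cases C) auto
    then show ?thesis
      using SumR.hyps(2)[of C2] SumR.prems weak_trans_Sum(2) by fastforce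
  qed
next
  case (ParL X \<mu> X' Y)
  show ?case
  proof (cases "\<exists>i. C = EqVar i")
    case True
    then show ?thesis
      using ParL transition.ParL[OF ParL.hyps(1), of Y] solution_step[OF assms(1,2)] by force
  next
    case False
    then obtain C1 C2 where C: "C = Par C1 C2" "X = inst P C1" "Y = inst P C2"
      using ParL by (cases C) auto
    then obtain C' T where "eqvars C' \<subseteq> I" "X' \<succeq>\<^sub>b\<^sub>i\<^sub>s inst P C'"
      "weak_trans (inst Q C1) \<mu> T" "T \<approx> inst Q C'"
      using ParL.hyps(2)[of C1] ParL.prems by auto
    \<comment> \<open>The inactive component stays in the new context as \<open>C2\<close>, still
      instantiated by \<open>P\<close> on one side and by \<open>Q\<close> on the other.\<close>
    then show ?thesis
      using C ParL.prems
      by (intro exI[of _ "Par C' C2"] exI[of _ "Par T (inst Q C2)"])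
        (simp add: contracts_Par contracts_refl weak_bisimilar_Par weak_bisimilar_refl weak_trans_ParL)
  qed
next
  case (ParR Y \<mu> Y' X)
  show ?case
  proof (cases "\<exists>i. C = EqVar i")
    case True
    then show ?thesis
      using ParR transition.ParR[OF ParR.hyps(1), of X] solution_step[OF assms(1,2)] by force
  next
    case False
    then obtain C1 C2 where C: "C = Par C1 C2" "X = inst P C1" "Y = inst P C2"
      using ParR by (cases C) auto
    then obtain C' T where "eqvars C' \<subseteq> I" "Y' \<succeq>\<^sub>b\<^sub>i\<^sub>s inst P C'"
      "weak_trans (inst Q C2) \<mu> T" "T \<approx> inst Q C'"
      using ParR.hyps(2)[of C2] ParR.prems by auto
    then show ?thesis
      using C ParR.prems
      by (intro exI[of _ "Par C1 C'"] exI[of _ "Par (inst Q C1) T"])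
        (simp add: contracts_Par contracts_refl weak_bisimilar_Par weak_bisimilar_refl weak_trans_ParR)
  qed
next
  case (Com X l X' Y Y')
  show ?case
  proof (cases "\<exists>i. C = EqVar i")
    case True
    then show ?thesis
      using Com transition.Com[OF Com.hyps(1,3)] solution_step[OF assms(1,2)] by force
  next
    case False
    then obtain C1 C2 where C: "C = Par C1 C2" "X = inst P C1" "Y = inst P C2"
      using Com by (cases C) auto
    obtain C1' T1 where "eqvars C1' \<subseteq> I" "X' \<succeq>\<^sub>b\<^sub>i\<^sub>s inst P C1'"
      "weak_trans (inst Q C1) (Vis l) T1" "T1 \<approx> inst Q C1'"
      using Com.hyps(2)[of C1] Com.prems C by auto
    moreover obtain C2' T2 where "eqvars C2' \<subseteq> I" "Y' \<succeq>\<^sub>b\<^sub>i\<^sub>s inst P C2'"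
      "weak_trans (inst Q C2) (Vis (complement l)) T2" "T2 \<approx> inst Q C2'"
      using Com.hyps(4)[of C2] Com.prems C by auto
    ultimately show ?thesis
      using C weak_trans_Com
      by (intro exI[of _ "Par C1' C2'"] exI[of _ "Par T1 T2"])
        (auto simp: contracts_Par weak_bisimilar_Par)
  qed
next
  case (Res X \<mu> X' a)
  show ?case
  proof (cases "\<exists>i. C = EqVar i")
    case True
    then show ?thesis
      using Res transition.Res[OF Res.hyps(1,3,4)] solution_step[OF assms(1,2)] by force
  next
    case False
    then obtain D where C: "C = Res a D" "X = inst P D"
      using Res by (cases C) auto
    then obtain C' T where "eqvars C' \<subseteq> I" "X' \<succeq>\<^sub>b\<^sub>i\<^sub>s inst P C'"
      "weak_trans (inst Q D) \<mu> T" "T \<approx> inst Q C'"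
      using Res.hyps(2)[of D] Res.prems by auto
    then show ?thesis
      using C Res.hyps(3,4)
      by (intro exI[of _ "Res a C'"] exI[of _ "Res a T"])
        (simp add: contracts_Res weak_bisimilar_Res weak_trans_Res)
  qed
next
  case (Rec X \<mu> X')
  show ?case
  proof (cases "\<exists>i. C = EqVar i")
    case True
    then show ?thesis
      using Rec transition.Rec[OF Rec.hyps(1)] solution_step[OF assms(1,2)] by force
  next
    case False
    then obtain D where C: "C = Rec D" "X = inst (\<lambda>i. lift 0 (P i)) D"
      using Rec by (cases C) auto
    have unfold: "agent_subst 0 (Rec X) X = inst P (agent_subst 0 (Rec D) D)"
      using inst_unfold_Rec[of P D] C by simp
    have "eqvars (agent_subst 0 (Rec D) D) \<subseteq> I"
      using eqvars_unfold_Rec[of D] Rec.prems C by simp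
    then obtain C' T where "eqvars C' \<subseteq> I" "X' \<succeq>\<^sub>b\<^sub>i\<^sub>s inst P C'"
      "weak_trans (inst Q (agent_subst 0 (Rec D) D)) \<mu> T" "T \<approx> inst Q C'"
      using Rec.hyps(2)[OF unfold] by blast
    moreover from this have "weak_trans (inst Q C) \<mu> T"
      using weak_trans_Rec inst_unfold_Rec[of Q D] C by (metis inst.simps(8))
    ultimately show ?thesis by blast
  qed
next
  case (Relab X \<mu> X' rf)
  show ?case
  proof (cases "\<exists>i. C = EqVar i")
    case True
    then show ?thesis
      using Relab transition.Relab[OF Relab.hyps(1), of rf] solution_step[OF assms(1,2)] by force
  next
    case False
    then obtain D where C: "C = Relab D rf" "X = inst P D"
      using Relab by (cases C) auto
    then obtain C' T where "eqvars C' \<subseteq> I" "X' \<succeq>\<^sub>b\<^sub>i\<^sub>s inst P C'"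
      "weak_trans (inst Q D) \<mu> T" "T \<approx> inst Q C'"
      using Relab.hyps(2)[of D] Relab.prems by auto
    then show ?thesis
      using C
      by (intro exI[of _ "Relab C' rf"] exI[of _ "Relab T rf"])
        (simp add: contracts_Relab weak_bisimilar_Relab weak_trans_Relab)
  qed
qed

section \<open>From single context steps to bisimilarity of the solutions\<close>

lemma weak_simulation_contexts:
  assumes "rooted_solution I E P" and "rooted_solution I E Q"
  shows "weak_simulation (\<lambda>R T. \<exists>C. eqvars C \<subseteq> I \<and> R \<succeq>\<^sub>b\<^sub>i\<^sub>s inst P C \<and> T \<approx> inst Q C)"
  unfolding weak_simulation_def
proof (intro allI impI, elim exE conjE)
  fix R T \<mu> R' C
  assume "transition R \<mu> R'" and C: "eqvars C \<subseteq> I" "R \<succeq>\<^sub>b\<^sub>i\<^sub>s inst P C" "T \<approx> inst Q C"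
  \<comment> \<open>Contraction on the left yields at most one strong step of
    \<open>inst P C\<close>, exactly the form that \<open>context_step\<close> accepts; a weak
    answer could consist of several steps.\<close>
  then obtain R1 where R1: "trans_hat (inst P C) \<mu> R1" "R' \<succeq>\<^sub>b\<^sub>i\<^sub>s R1"
    using contracts_step by blast
  show "\<exists>T'. weak_trans_hat T \<mu> T' \<and> (\<exists>C. eqvars C \<subseteq> I \<and> R' \<succeq>\<^sub>b\<^sub>i\<^sub>s inst P C \<and> T' \<approx> inst Q C)"
  proof (cases "transition (inst P C) \<mu> R1")
    case True
    then obtain C' S where C': "eqvars C' \<subseteq> I" "R1 \<succeq>\<^sub>b\<^sub>i\<^sub>s inst P C'"
      and S: "weak_trans (inst Q C) \<mu> S" "S \<approx> inst Q C'"
      using context_step[OF assms True C(1)] by blast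
    obtain T' where "weak_trans_hat T \<mu> T'" "S \<approx> T'"
      using weak_bisimilar_weak[OF weak_bisimilar_sym[OF C(3)] weak_trans_hatI[OF S(1)]] by blast
    then show ?thesis
      using C' S(2) R1(2) contracts_trans weak_bisimilar_trans weak_bisimilar_sym by blast
  next
    case False
    then have "\<mu> = Tau" "R1 = inst P C" using R1(1) by (auto simp: trans_hat_def)
    then show ?thesis using C R1(2) by (auto simp: weak_trans_hat_Tau intro: eps_trans_refl)
  qed
qed

text \<open>The relation \<open>S\<close> closes both sides under weak bisimilarity. This makes it
  symmetric under exchanging \<open>P\<close> and \<open>Q\<close>, so one simulation argument
  serves both directions.\<close>

lemma context_weak_bisimilar:
  assumes "rooted_solution I E P" and "rooted_solution I E Q" and "eqvars C \<subseteq> I"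
  shows "inst P C \<approx> inst Q C"
proof -
  define S where "S P Q A B \<longleftrightarrow> (\<exists>C. eqvars C \<subseteq> I \<and> A \<approx> inst P C \<and> B \<approx> inst Q C)"
    for P Q and A B :: "('a, 'i) ccs"
  have sim: "\<exists>B'. weak_trans_hat B \<mu> B' \<and> S P Q A' B'"
    if PQ: "rooted_solution I E P" "rooted_solution I E Q"
      and "S P Q A B" and "transition A \<mu> A'" for P Q A B \<mu> A'
  proof -
    obtain C where C: "eqvars C \<subseteq> I" "A \<approx> inst P C" "B \<approx> inst Q C"
      using \<open>S P Q A B\<close> unfolding S_def by blast
    obtain R where R: "weak_trans_hat (inst P C) \<mu> R" "A' \<approx> R"
      using weak_bisimilar_step[OF C(2) \<open>transition A \<mu> A'\<close>] by blast
    \<comment> \<open>The step of \<open>A\<close> has become a weak move of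
      \<open>inst P C\<close>. It is traced through the asymmetric simulation, started at
      \<open>inst P C\<close> itself by reflexivity of contraction.\<close>
    obtain T C' where "weak_trans_hat (inst Q C) \<mu> T"
      and C': "eqvars C' \<subseteq> I" "R \<succeq>\<^sub>b\<^sub>i\<^sub>s inst P C'" "T \<approx> inst Q C'"
      using weak_simulation_weak[OF weak_simulation_contexts[OF PQ] _ R(1), of "inst Q C"]
        C(1) contracts_refl weak_bisimilar_refl by blast
    then obtain B' where "weak_trans_hat B \<mu> B'" "T \<approx> B'"
      using weak_bisimilar_weak[OF weak_bisimilar_sym[OF C(3)]] by blast
    then show ?thesis
      unfolding S_def
      using C' R(2) contracts_imp_weak_bisimilar weak_bisimilar_trans weak_bisimilar_sym by meson
  qed
  have S_sym: "S P Q A B \<longleftrightarrow> S Q P B A" for A B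
    unfolding S_def by blast
  have "weak_bisimulation (S P Q)"
    unfolding weak_bisimulation_def
    using sim[OF assms(1,2)] sim[OF assms(2,1)] S_sym by metis
  moreover have "S P Q (inst P C) (inst Q C)"
    unfolding S_def using assms(3) weak_bisimilar_refl by blast
  ultimately show ?thesis unfolding weak_bisimilar_def by blast
qed

text \<open>The target found by \<open>solution_step\<close> is bisimilar to
  \<open>inst Q C'\<close>, hence to \<open>inst P C'\<close> and to \<open>R\<close>; the
  transition keeps its nonidle form, as rootedness demands.\<close>

lemma solution_weak_step:
  assumes "rooted_solution I E P" and "rooted_solution I E Q"
    and "i \<in> I" and "transition (P i) \<mu> R"
  shows "\<exists>T. weak_trans (Q i) \<mu> T \<and> R \<approx> T"
  using solution_step[OF assms] context_weak_bisimilar[OF assms(1,2)]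
    contracts_imp_weak_bisimilar weak_bisimilar_trans weak_bisimilar_sym by meson

lemma solution_rooted_bisimilar:
  assumes "rooted_solution I E P" and "rooted_solution I E Q" and "i \<in> I"
  shows "P i \<approx>\<^sup>c Q i"
  unfolding rooted_bisimilar_def
  using solution_weak_step[OF assms] solution_weak_step[OF assms(2,1,3)] weak_bisimilar_sym by meson

end

theorem theorem3p13:
  fixes I :: "'i set" and E P Q :: "'i \<Rightarrow> ('a, 'i) ccs"
  assumes "contraction_system I E"
    and "\<forall>i\<in>I. weakly_guarded (E i)"
    and "rooted_solution I E P"
    and "rooted_solution I E Q"
  shows "(\<forall>i\<in>I. P i \<approx>\<^sup>c Q i) \<and> (\<forall>i\<in>I. P i \<approx> Q i)"
proof -
  interpret weakly_guarded_system I E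
    using assms(1,2) by unfold_locales (auto simp: contraction_system_def)
  have "\<forall>i\<in>I. P i \<approx>\<^sup>c Q i"
    using solution_rooted_bisimilar assms(3,4) by blast
  then show ?thesis using rooted_bisimilar_imp_weak by blast
qed

end
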